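(* Let $\Lambda$ be a Frobenius $k$-algebra with nondegenerate multiplicative bilinear form $(-,-)$, and let $G$ be a finite group acting on $\Lambda$ by algebra automorphisms. Let $(-,-)$ also denote the bilinear form on $kG$ with $(h,l)=1$ if $h=l^{-1}$ and $(h,l)=0$ otherwise, for $h,l\in G$. Define a bilinear form on the skew group algebra $\Lambda G$ by $$\langle\lambda\otimes l,\mu\otimes m\rangle=(\lambda,l(\mu))\,(l,m)\qquad(\lambda,\mu\in\Lambda,\ l,m\in G),$$ extended bilinearly. Then the form $\langle-,-\rangle$ is multiplicative and nondegenerate. In particular, $\Lambda G$ is Frobenius.
   Context: $k$ is a field; algebras are associative, unital, finite dimensional over $k$. The skew group algebra $\Lambda G$ is $\Lambda\otimes_k kG$ with multiplication $(\lambda\otimes g)(\mu\otimes h)=\lambda g(\mu)\otimes gh$. A bilinear form on an algebra $A$ is multiplicative if $(a,bc)=(ab,c)$ for all $a,b,c\in A$. An algebra is Frobenius if it admits a nondegenerate multiplicative bilinear form. *)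

theory Defs
  imports
    "HOL-Algebra.Group_Action"
    "HOL-Algebra.QuotRing"
    "Jordan_Normal_Form.Missing_VectorSpace"
begin

text \<open>
  Associative unital algebras of finite dimension over a field. The locale of algebras in
  HOL-Algebra requires the multiplication to be commutative, so it cannot be used here.
\<close>

locale fd_algebra = vectorspace K A + A: ring A for K (structure) and A (structure) +
  assumes smult_mult_left:
      "\<lbrakk>c \<in> carrier K; x \<in> carrier A; y \<in> carrier A\<rbrakk>
        \<Longrightarrow> (c \<odot>\<^bsub>A\<^esub> x) \<otimes>\<^bsub>A\<^esub> y = c \<odot>\<^bsub>A\<^esub> (x \<otimes>\<^bsub>A\<^esub> y)"
    and smult_mult_right:
      "\<lbrakk>c \<in> carrier K; x \<in> carrier A; y \<in> carrier A\<rbrakk>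
        \<Longrightarrow> x \<otimes>\<^bsub>A\<^esub> (c \<odot>\<^bsub>A\<^esub> y) = c \<odot>\<^bsub>A\<^esub> (x \<otimes>\<^bsub>A\<^esub> y)"
    and finite_dimensional: "fin_dim"


definition bilinear_map ::
  "('k, 'm) ring_scheme \<Rightarrow> ('k, 'a, 'n) module_scheme \<Rightarrow> ('k, 'b, 'o) module_scheme \<Rightarrow>
   ('k, 'c, 'p) module_scheme \<Rightarrow> ('a \<Rightarrow> 'b \<Rightarrow> 'c) \<Rightarrow> bool"
  where "bilinear_map K U V W f \<longleftrightarrow>
    (\<forall>u \<in> carrier U. f u \<in> module_hom K V W) \<and>
    (\<forall>v \<in> carrier V. (\<lambda>u. f u v) \<in> module_hom K U W)"

definition bilinear_form ::
  "('k, 'm) ring_scheme \<Rightarrow> ('k, 'a, 'n) module_scheme \<Rightarrow> ('a \<Rightarrow> 'a \<Rightarrow> 'k) \<Rightarrow> bool"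
  where "bilinear_form K A B \<longleftrightarrow>
    (\<forall>x \<in> carrier A. \<forall>y \<in> carrier A. B x y \<in> carrier K) \<and>
    (\<forall>x \<in> carrier A. \<forall>y \<in> carrier A. \<forall>z \<in> carrier A.
      B (x \<oplus>\<^bsub>A\<^esub> y) z = B x z \<oplus>\<^bsub>K\<^esub> B y z \<and>
      B x (y \<oplus>\<^bsub>A\<^esub> z) = B x y \<oplus>\<^bsub>K\<^esub> B x z) \<and>
    (\<forall>c \<in> carrier K. \<forall>x \<in> carrier A. \<forall>y \<in> carrier A.
      B (c \<odot>\<^bsub>A\<^esub> x) y = c \<otimes>\<^bsub>K\<^esub> B x y \<and>
      B x (c \<odot>\<^bsub>A\<^esub> y) = c \<otimes>\<^bsub>K\<^esub> B x y)"

definition multiplicative_form :: "('a, 'n) ring_scheme \<Rightarrow> ('a \<Rightarrow> 'a \<Rightarrow> 'k) \<Rightarrow> bool"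
  where "multiplicative_form A B \<longleftrightarrow>
    (\<forall>a \<in> carrier A. \<forall>b \<in> carrier A. \<forall>c \<in> carrier A.
      B a (b \<otimes>\<^bsub>A\<^esub> c) = B (a \<otimes>\<^bsub>A\<^esub> b) c)"

definition nondegenerate_form ::
  "('k, 'm) ring_scheme \<Rightarrow> ('a, 'n) ring_scheme \<Rightarrow> ('a \<Rightarrow> 'a \<Rightarrow> 'k) \<Rightarrow> bool"
  where "nondegenerate_form K A B \<longleftrightarrow>
    (\<forall>x \<in> carrier A. (\<forall>y \<in> carrier A. B x y = \<zero>\<^bsub>K\<^esub>) \<longrightarrow> x = \<zero>\<^bsub>A\<^esub>) \<and>
    (\<forall>y \<in> carrier A. (\<forall>x \<in> carrier A. B x y = \<zero>\<^bsub>K\<^esub>) \<longrightarrow> y = \<zero>\<^bsub>A\<^esub>)"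

definition frobenius_algebra ::
  "('k, 'm) ring_scheme \<Rightarrow> ('k, 'a, 'n) module_scheme \<Rightarrow> bool"
  where "frobenius_algebra K A \<longleftrightarrow> fd_algebra K A \<and>
    (\<exists>B. bilinear_form K A B \<and> multiplicative_form A B \<and> nondegenerate_form K A B)"


text \<open>
  The locale \<open>group_action\<close> expresses that \<open>\<phi>\<close> is a homomorphism from the group \<open>G\<close> to the
  bijections of the carrier; it fixes the values of \<open>\<phi> g\<close> outside the carrier to \<open>undefined\<close>.
\<close>

locale finite_group_algebra_action =
  fd_algebra K \<Lambda> + action: group_action G "carrier \<Lambda>" \<phi>
  for K (structure) and \<Lambda> (structure) and G (structure) and \<phi> +
  assumes finite_group: "finite (carrier G)"
    and ring_automorphism: "g \<in> carrier G \<Longrightarrow> \<phi> g \<in> ring_iso \<Lambda> \<Lambda>"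
    and linear: "g \<in> carrier G \<Longrightarrow> \<phi> g \<in> module_hom K \<Lambda> \<Lambda>"


text \<open>
  For a finite group \<open>G\<close>, the group algebra consists of the functions from \<open>G\<close> to \<open>K\<close>;
  the function \<open>a\<close> stands for the sum of the elements \<open>a g\<close> times \<open>g\<close>.
\<close>

definition group_algebra ::
  "('k, 'm) ring_scheme \<Rightarrow> ('g, 'p) monoid_scheme \<Rightarrow> ('k, 'g \<Rightarrow> 'k) module"
  where "group_algebra K G =
    \<lparr>carrier = carrier G \<rightarrow>\<^sub>E carrier K,
     mult = (\<lambda>a b. \<lambda>s \<in> carrier G.
       finsum K (\<lambda>(g, h). a g \<otimes>\<^bsub>K\<^esub> b h)
         {(g, h) \<in> carrier G \<times> carrier G. g \<otimes>\<^bsub>G\<^esub> h = s}),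
     one = (\<lambda>s \<in> carrier G. if s = \<one>\<^bsub>G\<^esub> then \<one>\<^bsub>K\<^esub> else \<zero>\<^bsub>K\<^esub>),
     zero = (\<lambda>s \<in> carrier G. \<zero>\<^bsub>K\<^esub>),
     add = (\<lambda>a b. \<lambda>s \<in> carrier G. a s \<oplus>\<^bsub>K\<^esub> b s),
     smult = (\<lambda>c a. \<lambda>s \<in> carrier G. c \<otimes>\<^bsub>K\<^esub> a s)\<rparr>"

definition group_elem :: "('k, 'm) ring_scheme \<Rightarrow> ('g, 'p) monoid_scheme \<Rightarrow> 'g \<Rightarrow> 'g \<Rightarrow> 'k"
  where "group_elem K G g = (\<lambda>s \<in> carrier G. if s = g then \<one>\<^bsub>K\<^esub> else \<zero>\<^bsub>K\<^esub>)"

definition group_form ::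
  "('k, 'm) ring_scheme \<Rightarrow> ('g, 'p) monoid_scheme \<Rightarrow> ('g \<Rightarrow> 'k) \<Rightarrow> ('g \<Rightarrow> 'k) \<Rightarrow> 'k"
  where "group_form K G a b =
    (\<Oplus>\<^bsub>K\<^esub>h \<in> carrier G. \<Oplus>\<^bsub>K\<^esub>l \<in> carrier G.
      (a h \<otimes>\<^bsub>K\<^esub> b l) \<otimes>\<^bsub>K\<^esub> (if h = inv\<^bsub>G\<^esub> l then \<one>\<^bsub>K\<^esub> else \<zero>\<^bsub>K\<^esub>))"


text \<open>
  The tensor product of \<open>\<Lambda>\<close> with the group algebra is realised as the space of functions
  from \<open>G\<close> to \<open>\<Lambda>\<close>: as the group elements form a basis of the group algebra, every tensor is
  a unique sum of the elements \<open>x g \<otimes> g\<close>, and the function \<open>x\<close> stands for this sum.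
  The lemmas \<open>tensor_bilinear\<close> and \<open>tensor_universal\<close> below show that this space, together
  with the map \<open>tensor\<close>, has the universal property of the tensor product over \<open>K\<close>.
  The multiplication is the additive extension of the rule for pure tensors stated in
  \<open>tensor_mult\<close>: the component at \<open>s\<close> collects the products of \<open>x g \<otimes> g\<close> and \<open>y h \<otimes> h\<close>
  over all factorisations \<open>s = g h\<close>.
\<close>

definition skew_group_algebra ::
  "('k, 'a, 'n) module_scheme \<Rightarrow> ('g, 'p) monoid_scheme \<Rightarrow> ('g \<Rightarrow> 'a \<Rightarrow> 'a) \<Rightarrow>
   ('k, 'g \<Rightarrow> 'a) module"
  where "skew_group_algebra \<Lambda> G \<phi> =
    \<lparr>carrier = carrier G \<rightarrow>\<^sub>E carrier \<Lambda>,
     mult = (\<lambda>x y. \<lambda>s \<in> carrier G.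
       finsum \<Lambda> (\<lambda>(g, h). x g \<otimes>\<^bsub>\<Lambda>\<^esub> \<phi> g (y h))
         {(g, h) \<in> carrier G \<times> carrier G. g \<otimes>\<^bsub>G\<^esub> h = s}),
     one = (\<lambda>s \<in> carrier G. if s = \<one>\<^bsub>G\<^esub> then \<one>\<^bsub>\<Lambda>\<^esub> else \<zero>\<^bsub>\<Lambda>\<^esub>),
     zero = (\<lambda>s \<in> carrier G. \<zero>\<^bsub>\<Lambda>\<^esub>),
     add = (\<lambda>x y. \<lambda>s \<in> carrier G. x s \<oplus>\<^bsub>\<Lambda>\<^esub> y s),
     smult = (\<lambda>c x. \<lambda>s \<in> carrier G. c \<odot>\<^bsub>\<Lambda>\<^esub> x s)\<rparr>"

definition tensor ::
  "('k, 'a, 'n) module_scheme \<Rightarrow> ('g, 'p) monoid_scheme \<Rightarrow> 'a \<Rightarrow> ('g \<Rightarrow> 'k) \<Rightarrow> 'g \<Rightarrow> 'a"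
  where "tensor \<Lambda> G v a = (\<lambda>s \<in> carrier G. a s \<odot>\<^bsub>\<Lambda>\<^esub> v)"

text \<open>
  The bilinear extension of the values on pure tensors stated in \<open>skew_form_tensor\<close>.
\<close>

definition skew_form ::
  "('k, 'm) ring_scheme \<Rightarrow> ('g, 'p) monoid_scheme \<Rightarrow> ('g \<Rightarrow> 'a \<Rightarrow> 'a) \<Rightarrow>
   ('a \<Rightarrow> 'a \<Rightarrow> 'k) \<Rightarrow> ('g \<Rightarrow> 'a) \<Rightarrow> ('g \<Rightarrow> 'a) \<Rightarrow> 'k"
  where "skew_form K G \<phi> B x y =
    (\<Oplus>\<^bsub>K\<^esub>l \<in> carrier G. \<Oplus>\<^bsub>K\<^esub>m \<in> carrier G.
      B (x l) (\<phi> l (y m)) \<otimes>\<^bsub>K\<^esub> group_form K G (group_elem K G l) (group_elem K G m))"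

lemma hom_expand_sum:
  fixes W (structure)
  assumes W: "abelian_group W" and fin: "finite S"
    and z: "z \<in> C" "\<And>c. c \<in> C \<Longrightarrow> pl z c = c" "\<And>c. c \<in> C \<Longrightarrow> pl c z = c"
    and closed: "\<And>x. x \<in> S \<rightarrow>\<^sub>E C \<Longrightarrow> T x \<in> carrier W"
    and pl: "\<And>x y. x \<in> S \<rightarrow>\<^sub>E C \<Longrightarrow> y \<in> S \<rightarrow>\<^sub>E C \<Longrightarrow>
      T (\<lambda>s \<in> S. pl (x s) (y s)) = T x \<oplus> T y"
    and zero: "T (\<lambda>s \<in> S. z) = \<zero>"
    and x: "x \<in> S \<rightarrow>\<^sub>E C"
  shows "T x = (\<Oplus>g \<in> S. T (\<lambda>s \<in> S. if s = g then x g else z))"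
proof -
  interpret W: abelian_group W by (rule W)
  have xC: "x s \<in> C" if "s \<in> S" for s
    using x that by auto
  have "T (\<lambda>s \<in> S. if s \<in> R then x s else z)
      = (\<Oplus>g \<in> R. T (\<lambda>s \<in> S. if s = g then x g else z))" if "finite R" "R \<subseteq> S" for R
    using that
  proof (induction R)
    case empty
    then show ?case using zero by (simp add: restrict_def)
  next
    case (insert g R)
    have "(\<lambda>s \<in> S. if s \<in> insert g R then x s else z)
        = (\<lambda>s \<in> S. pl ((\<lambda>s \<in> S. if s = g then x g else z) s)
            ((\<lambda>s \<in> S. if s \<in> R then x s else z) s))"
      using insert z xC by (auto intro!: restrict_ext)
    then have "T (\<lambda>s \<in> S. if s \<in> insert g R then x s else z)
        = T (\<lambda>s \<in> S. if s = g then x g else z) \<oplus> T (\<lambda>s \<in> S. if s \<in> R then x s else z)"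
      using insert.prems xC z(1) by (simp only:) (intro pl; auto)
    moreover have "(\<Oplus>g \<in> insert g R. T (\<lambda>s \<in> S. if s = g then x g else z))
        = T (\<lambda>s \<in> S. if s = g then x g else z)
          \<oplus> (\<Oplus>g \<in> R. T (\<lambda>s \<in> S. if s = g then x g else z))"
      using insert.hyps insert.prems xC z(1) by (intro W.finsum_insert Pi_I closed) auto
    moreover have "T (\<lambda>s \<in> S. if s \<in> R then x s else z)
        = (\<Oplus>g \<in> R. T (\<lambda>s \<in> S. if s = g then x g else z))"
      using insert.IH insert.prems by blast
    ultimately show ?case by (simp only:)
  qed
  from this[OF fin] have "T (\<lambda>s \<in> S. if s \<in> S then x s else z)
      = (\<Oplus>g \<in> S. T (\<lambda>s \<in> S. if s = g then x g else z))" by simp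
  moreover have "(\<lambda>s \<in> S. if s \<in> S then x s else z) = x"
    using x by (auto simp: fun_eq_iff PiE_def extensional_def)
  ultimately show ?thesis by simp
qed

context finite_group_algebra_action
begin

abbreviation \<Lambda>G where "\<Lambda>G \<equiv> skew_group_algebra \<Lambda> G \<phi>"
abbreviation kG where "kG \<equiv> group_algebra K G"
abbreviation elem where "elem \<equiv> group_elem K G"

lemma group_G: "group G"
  using action.group_hom by (simp add: group_hom_def)

lemma act_closed: "g \<in> carrier G \<Longrightarrow> v \<in> carrier \<Lambda> \<Longrightarrow> \<phi> g v \<in> carrier \<Lambda>"
  using linear[of g] by (auto simp: module_hom_def)

lemma act_zero: "g \<in> carrier G \<Longrightarrow> \<phi> g \<zero>\<^bsub>\<Lambda>\<^esub> = \<zero>\<^bsub>\<Lambda>\<^esub>"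
  using ring_automorphism[of g] A.ring_axioms
  by (auto simp: ring_iso_def intro: ring_hom_zero)

lemma group_form_elem:
  assumes "h \<in> carrier G" "l \<in> carrier G"
  shows "group_form K G (elem h) (elem l) = (if h = inv\<^bsub>G\<^esub> l then \<one> else \<zero>)"
proof -
  interpret G: group G by (rule group_G)
  let ?c = "\<lambda>h l. if h = inv\<^bsub>G\<^esub> l then \<one> else \<zero>"
  have inner: "(\<Oplus>l' \<in> carrier G. (elem h h' \<otimes> elem l l') \<otimes> ?c h' l')
      = (if h = h' then ?c h l else \<zero>)" if "h' \<in> carrier G" for h'
  proof -
    have "(\<Oplus>l' \<in> carrier G. (elem h h' \<otimes> elem l l') \<otimes> ?c h' l')
       = (\<Oplus>l' \<in> carrier G. if l = l' then (if h = h' then ?c h l' else \<zero>) else \<zero>)"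
      using that assms by (intro R.finsum_cong') (auto simp: group_elem_def)
    also have "\<dots> = (if h = h' then ?c h l else \<zero>)"
      using assms finite_group by (subst R.finsum_singleton) auto
    finally show ?thesis .
  qed
  have "group_form K G (elem h) (elem l)
      = (\<Oplus>h' \<in> carrier G. if h = h' then ?c h l else \<zero>)"
    unfolding group_form_def using inner by (intro R.finsum_cong') auto
  also have "\<dots> = ?c h l"
    using assms finite_group by (subst R.finsum_singleton[where f = "\<lambda>_. ?c h l"]) auto
  finally show ?thesis .
qed

lemma tensor_elem:
  "g \<in> carrier G \<Longrightarrow> v \<in> carrier \<Lambda> \<Longrightarrow>
    tensor \<Lambda> G v (elem g) = (\<lambda>s \<in> carrier G. if s = g then v else \<zero>\<^bsub>\<Lambda>\<^esub>)"
  by (auto simp: tensor_def group_elem_def)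

lemma tensor_mult:
  assumes "v \<in> carrier \<Lambda>" "w \<in> carrier \<Lambda>" "g \<in> carrier G" "h \<in> carrier G"
  shows "tensor \<Lambda> G v (elem g) \<otimes>\<^bsub>\<Lambda>G\<^esub> tensor \<Lambda> G w (elem h)
    = tensor \<Lambda> G (v \<otimes>\<^bsub>\<Lambda>\<^esub> \<phi> g w) (elem (g \<otimes>\<^bsub>G\<^esub> h))"
proof -
  interpret G: group G by (rule group_G)
  let ?t = "\<lambda>v g. \<lambda>s \<in> carrier G. if s = g then v else \<zero>\<^bsub>\<Lambda>\<^esub>"
  let ?P = "\<lambda>s. {(g, h) \<in> carrier G \<times> carrier G. g \<otimes>\<^bsub>G\<^esub> h = s}"
  have "finsum \<Lambda> (\<lambda>(g', h'). ?t v g g' \<otimes>\<^bsub>\<Lambda>\<^esub> \<phi> g' (?t w h h')) (?P s)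
      = (if s = g \<otimes>\<^bsub>G\<^esub> h then v \<otimes>\<^bsub>\<Lambda>\<^esub> \<phi> g w else \<zero>\<^bsub>\<Lambda>\<^esub>)" (is "?S = _")
    if "s \<in> carrier G" for s
  proof -
    have fin: "finite (?P s)"
      by (rule finite_subset[of _ "carrier G \<times> carrier G"]) (auto simp: finite_group)
    have S: "?S = (\<Oplus>\<^bsub>\<Lambda>\<^esub>p \<in> ?P s. if (g, h) = p then v \<otimes>\<^bsub>\<Lambda>\<^esub> \<phi> g w else \<zero>\<^bsub>\<Lambda>\<^esub>)"
      using assms by (intro M.finsum_cong') (auto simp: act_zero act_closed split: if_splits)
    show ?thesis
    proof (cases "s = g \<otimes>\<^bsub>G\<^esub> h")
      case True
      then show ?thesis unfolding S using assms fin
        by (subst M.finsum_singleton[where f = "\<lambda>_. v \<otimes>\<^bsub>\<Lambda>\<^esub> \<phi> g w"]) (auto simp: act_closed)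
    next
      case False
      have "?S = (\<Oplus>\<^bsub>\<Lambda>\<^esub>p \<in> ?P s. \<zero>\<^bsub>\<Lambda>\<^esub>)"
        unfolding S using False by (intro M.finsum_cong') auto
      then show ?thesis using False by simp
    qed
  qed
  then show ?thesis
    using assms
    by (simp add: tensor_elem act_closed skew_group_algebra_def cong: restrict_cong)
qed

lemma skew_form_tensor:
  assumes B: "bilinear_form K \<Lambda> B"
    and "v \<in> carrier \<Lambda>" "w \<in> carrier \<Lambda>" "l \<in> carrier G" "m \<in> carrier G"
  shows "skew_form K G \<phi> B (tensor \<Lambda> G v (elem l)) (tensor \<Lambda> G w (elem m))
    = B v (\<phi> l w) \<otimes> group_form K G (elem l) (elem m)"
proof -
  have Bc: "B x y \<in> carrier K" if "x \<in> carrier \<Lambda>" "y \<in> carrier \<Lambda>" for x y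
    using B that by (auto simp: bilinear_form_def)
  have sc0: "\<zero> \<odot>\<^bsub>\<Lambda>\<^esub> x = \<zero>\<^bsub>\<Lambda>\<^esub>" if "x \<in> carrier \<Lambda>" for x
    using that by (rule lmult_0)
  have B0: "B \<zero>\<^bsub>\<Lambda>\<^esub> x = \<zero>" "B x \<zero>\<^bsub>\<Lambda>\<^esub> = \<zero>" if "x \<in> carrier \<Lambda>" for x
  proof -
    have "B (\<zero> \<odot>\<^bsub>\<Lambda>\<^esub> x) x = \<zero> \<otimes> B x x" "B x (\<zero> \<odot>\<^bsub>\<Lambda>\<^esub> x) = \<zero> \<otimes> B x x"
      using B that R.zero_closed unfolding bilinear_form_def by blast+
    then show "B \<zero>\<^bsub>\<Lambda>\<^esub> x = \<zero>" "B x \<zero>\<^bsub>\<Lambda>\<^esub> = \<zero>"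
      using that Bc[of x x] by (simp_all only: sc0 R.l_null)
  qed
  let ?t = "\<lambda>v g. \<lambda>s \<in> carrier G. if s = g then v else \<zero>\<^bsub>\<Lambda>\<^esub>"
  let ?F = "\<lambda>l m. group_form K G (elem l) (elem m)"
  have F: "?F l m \<in> carrier K" if "l \<in> carrier G" "m \<in> carrier G" for l m
    using that by (simp add: group_form_elem)
  have inner: "(\<Oplus>m' \<in> carrier G. B (?t v l l') (\<phi> l' (?t w m m')) \<otimes> ?F l' m')
      = (if l = l' then B v (\<phi> l w) \<otimes> ?F l m else \<zero>)" if "l' \<in> carrier G" for l'
  proof -
    have "(\<Oplus>m' \<in> carrier G. B (?t v l l') (\<phi> l' (?t w m m')) \<otimes> ?F l' m')
       = (\<Oplus>m' \<in> carrier G. if m = m' then (if l = l' then B v (\<phi> l w) \<otimes> ?F l m' else \<zero>) else \<zero>)"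
      using that assms
      by (intro R.finsum_cong') (auto simp: B0 act_zero act_closed Bc F)
    also have "\<dots> = (if l = l' then B v (\<phi> l w) \<otimes> ?F l m else \<zero>)"
      using assms finite_group
      by (subst R.finsum_singleton) (auto simp: Bc F act_closed)
    finally show ?thesis .
  qed
  have "skew_form K G \<phi> B (?t v l) (?t w m)
      = (\<Oplus>l' \<in> carrier G. if l = l' then B v (\<phi> l w) \<otimes> ?F l m else \<zero>)"
    unfolding skew_form_def using inner assms
    by (intro R.finsum_cong') (auto simp: Bc F act_closed)
  also have "\<dots> = B v (\<phi> l w) \<otimes> ?F l m"
    using assms finite_group
    by (subst R.finsum_singleton[where f = "\<lambda>_. B v (\<phi> l w) \<otimes> ?F l m"])
      (auto simp: Bc F act_closed)
  finally show ?thesis using assms by (simp add: tensor_elem)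
qed

lemma tensor_bilinear: "bilinear_map K \<Lambda> kG \<Lambda>G (tensor \<Lambda> G)"
  by (auto simp: bilinear_map_def module_hom_def tensor_def group_algebra_def
      skew_group_algebra_def PiE_iff smult_l_distr smult_r_distr smult_assoc1
      intro!: restrict_ext)
     (simp_all add: smult_assoc1[symmetric] R.m_comm)

lemma tensor_universal:
  assumes W: "module K W" and f: "bilinear_map K \<Lambda> kG W f"
  shows "\<exists>T \<in> module_hom K \<Lambda>G W.
      (\<forall>v \<in> carrier \<Lambda>. \<forall>a \<in> carrier kG. T (tensor \<Lambda> G v a) = f v a) \<and>
      (\<forall>T' \<in> module_hom K \<Lambda>G W.
        (\<forall>v \<in> carrier \<Lambda>. \<forall>a \<in> carrier kG. T' (tensor \<Lambda> G v a) = f v a) \<longrightarrow>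
        (\<forall>x \<in> carrier \<Lambda>G. T' x = T x))"
proof -
  interpret W: module K W by (rule W)
  have elem_kG: "elem g \<in> carrier kG" for g
    by (auto simp: group_elem_def group_algebra_def)
  have fR: "f v \<in> module_hom K kG W" if "v \<in> carrier \<Lambda>" for v
    using f that by (auto simp: bilinear_map_def)
  have fL: "(\<lambda>v. f v a) \<in> module_hom K \<Lambda> W" if "a \<in> carrier kG" for a
    using f that by (auto simp: bilinear_map_def)
  have fc: "f v a \<in> carrier W" if "v \<in> carrier \<Lambda>" "a \<in> carrier kG" for v a
    using fR[OF that(1)] that(2) by (auto simp: module_hom_def)
  have xc: "x g \<in> carrier \<Lambda>" if "x \<in> carrier \<Lambda>G" "g \<in> carrier G" for x g
    using that by (auto simp: skew_group_algebra_def)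
  define T where "T x = (\<Oplus>\<^bsub>W\<^esub>g \<in> carrier G. f (x g) (elem g))" for x
  have T_hom: "T \<in> module_hom K \<Lambda>G W"
    unfolding module_hom_def
  proof (intro CollectI conjI allI impI)
    show "T \<in> carrier \<Lambda>G \<rightarrow> carrier W"
      by (auto simp: T_def intro!: W.M.finsum_closed fc xc elem_kG)
  next
    fix x y assume xy: "x \<in> carrier \<Lambda>G \<and> y \<in> carrier \<Lambda>G"
    have "T (x \<oplus>\<^bsub>\<Lambda>G\<^esub> y) = (\<Oplus>\<^bsub>W\<^esub>g \<in> carrier G. f (x g) (elem g) \<oplus>\<^bsub>W\<^esub> f (y g) (elem g))"
      unfolding T_def using xy module_hom_add[OF fL[OF elem_kG]]
      by (intro W.M.finsum_cong')
        (auto simp: skew_group_algebra_def PiE_iff intro!: W.M.a_closed fc elem_kG)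
    also have "\<dots> = T x \<oplus>\<^bsub>W\<^esub> T y"
      unfolding T_def using xy by (intro W.M.finsum_addf) (auto intro!: fc xc elem_kG)
    finally show "T (x \<oplus>\<^bsub>\<Lambda>G\<^esub> y) = T x \<oplus>\<^bsub>W\<^esub> T y" .
  next
    fix c x assume cx: "c \<in> carrier K \<and> x \<in> carrier \<Lambda>G"
    have "T (c \<odot>\<^bsub>\<Lambda>G\<^esub> x) = (\<Oplus>\<^bsub>W\<^esub>g \<in> carrier G. c \<odot>\<^bsub>W\<^esub> f (x g) (elem g))"
      unfolding T_def using cx module_hom_smult[OF fL[OF elem_kG]]
      by (intro W.M.finsum_cong')
        (auto simp: skew_group_algebra_def PiE_iff intro!: W.smult_closed fc elem_kG)
    also have "\<dots> = c \<odot>\<^bsub>W\<^esub> T x"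
      unfolding T_def using cx finite_group
      by (intro W.finsum_smult_ldistr[symmetric]) (auto intro!: fc xc elem_kG)
    finally show "T (c \<odot>\<^bsub>\<Lambda>G\<^esub> x) = c \<odot>\<^bsub>W\<^esub> T x" .
  qed
  have T_tensor: "T (tensor \<Lambda> G v a) = f v a" if v: "v \<in> carrier \<Lambda>" and a: "a \<in> carrier kG" for v a
  proof -
    have ac: "a g \<in> carrier K" if "g \<in> carrier G" for g
      using a that by (auto simp: group_algebra_def)
    have "f v (\<lambda>s \<in> carrier G. \<zero>) = f v (\<zero> \<odot>\<^bsub>kG\<^esub> elem \<one>\<^bsub>G\<^esub>)"
      by (auto simp: group_algebra_def group_elem_def intro!: arg_cong[of _ _ "f v"])
    also have "\<dots> = \<zero>\<^bsub>W\<^esub>"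
      using module_hom_smult[OF fR[OF v] _ elem_kG] fc[OF v elem_kG] by simp
    finally have f0: "f v (\<lambda>s \<in> carrier G. \<zero>) = \<zero>\<^bsub>W\<^esub>" .
    have "f v a = (\<Oplus>\<^bsub>W\<^esub>g \<in> carrier G. f v (\<lambda>s \<in> carrier G. if s = g then a g else \<zero>))"
      using a fc[OF v] module_hom_add[OF fR[OF v]] f0
      by (intro hom_expand_sum[where C = "carrier K" and pl = "add K"])
        (simp_all add: group_algebra_def finite_group restrict_def W.M.abelian_group_axioms)
    also have "\<dots> = (\<Oplus>\<^bsub>W\<^esub>g \<in> carrier G. f (a g \<odot>\<^bsub>\<Lambda>\<^esub> v) (elem g))"
    proof (intro W.M.finsum_cong')
      fix g assume g: "g \<in> carrier G"
      have "f v (\<lambda>s \<in> carrier G. if s = g then a g else \<zero>) = f v (a g \<odot>\<^bsub>kG\<^esub> elem g)"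
        using ac g by (auto simp: group_algebra_def group_elem_def intro!: arg_cong[of _ _ "f v"])
      also have "\<dots> = a g \<odot>\<^bsub>W\<^esub> f v (elem g)"
        by (rule module_hom_smult[OF fR[OF v] ac[OF g] elem_kG])
      also have "\<dots> = f (a g \<odot>\<^bsub>\<Lambda>\<^esub> v) (elem g)"
        by (rule module_hom_smult[OF fL[OF elem_kG] ac[OF g] v, symmetric])
      finally show "f v (\<lambda>s \<in> carrier G. if s = g then a g else \<zero>)
        = f (a g \<odot>\<^bsub>\<Lambda>\<^esub> v) (elem g)" .
    qed (auto intro!: fc elem_kG smult_closed ac v)
    also have "\<dots> = T (tensor \<Lambda> G v a)"
      unfolding T_def
      by (intro W.M.finsum_cong') (auto simp: tensor_def intro!: fc elem_kG smult_closed ac v)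
    finally show ?thesis by simp
  qed
  have unique: "T' x = T x"
    if T': "T' \<in> module_hom K \<Lambda>G W"
      and eq: "\<forall>v \<in> carrier \<Lambda>. \<forall>a \<in> carrier kG. T' (tensor \<Lambda> G v a) = f v a"
      and x: "x \<in> carrier \<Lambda>G" for T' x
  proof -
    have tc: "tensor \<Lambda> G v a \<in> carrier \<Lambda>G" if "v \<in> carrier \<Lambda>" "a \<in> carrier kG" for v a
      using that by (auto simp: tensor_def skew_group_algebra_def group_algebra_def PiE_iff)
    have z: "(\<lambda>s \<in> carrier G. \<zero>\<^bsub>\<Lambda>\<^esub>) \<in> carrier \<Lambda>G"
      by (auto simp: skew_group_algebra_def)
    have T'c: "T' y \<in> carrier W" if "y \<in> carrier \<Lambda>G" for y
      using T' that by (auto simp: module_hom_def)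
    have "T' (\<lambda>s \<in> carrier G. \<zero>\<^bsub>\<Lambda>\<^esub>) = T' (\<zero> \<odot>\<^bsub>\<Lambda>G\<^esub> (\<lambda>s \<in> carrier G. \<zero>\<^bsub>\<Lambda>\<^esub>))"
      by (auto simp: skew_group_algebra_def intro!: arg_cong[of _ _ T'])
    also have "\<dots> = \<zero>\<^bsub>W\<^esub>"
      using module_hom_smult[OF T' _ z] T'c[OF z] by simp
    finally have T'0: "T' (\<lambda>s \<in> carrier G. \<zero>\<^bsub>\<Lambda>\<^esub>) = \<zero>\<^bsub>W\<^esub>" .
    have "T' x = (\<Oplus>\<^bsub>W\<^esub>g \<in> carrier G. T' (\<lambda>s \<in> carrier G. if s = g then x g else \<zero>\<^bsub>\<Lambda>\<^esub>))"
      using x T'c module_hom_add[OF T'] T'0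
      by (intro hom_expand_sum[where C = "carrier \<Lambda>" and pl = "add \<Lambda>"])
        (simp_all add: skew_group_algebra_def finite_group restrict_def W.M.abelian_group_axioms)
    also have "\<dots> = T x"
      unfolding T_def using eq x
      by (intro W.M.finsum_cong') (auto simp: tensor_elem[symmetric] xc elem_kG intro!: fc)
    finally show ?thesis .
  qed
  show ?thesis
    using T_hom T_tensor unique by (intro bexI[of _ T]) auto
qed

end

end

theory Submission
  imports Defs
begin

text \<open>
  The form \<open>B\<close> is determined by the functional \<open>B \<one>\<close>, since \<open>B a b = B \<one> (a b)\<close>. The skew form
  comes from the functional on the skew group algebra that applies \<open>B \<one>\<close> to the component
  at the neutral element. Hence its multiplicativity is the associativity of the skew group
  algebra, and its bilinearity is that of the product. Pairing an element with
  those supported at a single group element reduces nondegeneracy to that of \<open>B\<close>.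
\<close>

section \<open>Additive maps on finite sums and elementary rules for bilinear forms\<close>

text \<open>Induction on the index set. Source and target are arbitrary abelian monoids because the
  lemma serves both an action map \<open>\<phi> g\<close> on \<open>\<Lambda>\<close> and the
  functional \<open>B \<one>\<close> from \<open>\<Lambda>\<close> to \<open>K\<close>.\<close>

lemma finsum_additive:
  fixes V (structure) and W (structure)
  assumes V: "abelian_monoid V" and W: "abelian_monoid W"
    and closed: "\<And>x. x \<in> carrier V \<Longrightarrow> f x \<in> carrier W"
    and zero: "f \<zero>\<^bsub>V\<^esub> = \<zero>\<^bsub>W\<^esub>"
    and additive: "\<And>x y. x \<in> carrier V \<Longrightarrow> y \<in> carrier V \<Longrightarrow> f (x \<oplus>\<^bsub>V\<^esub> y) = f x \<oplus>\<^bsub>W\<^esub> f y"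
    and u: "u \<in> S \<rightarrow> carrier V"
  shows "f (\<Oplus>\<^bsub>V\<^esub>s \<in> S. u s) = (\<Oplus>\<^bsub>W\<^esub>s \<in> S. f (u s))"
proof -
  interpret V: abelian_monoid V by (rule V)
  interpret W: abelian_monoid W by (rule W)
  show ?thesis
    using u
  proof (induction S rule: infinite_finite_induct)
    \<comment> \<open>A sum over an infinite index set is zero by convention, so this case is
      preservation of zero.\<close>
    case (infinite S)
    then show ?case by (simp add: V.finsum_infinite W.finsum_infinite zero)
  next
    case empty
    then show ?case by (simp add: zero)
  next
    case (insert s S)
    have "f (\<Oplus>\<^bsub>V\<^esub>t \<in> insert s S. u t) = f (u s) \<oplus>\<^bsub>W\<^esub> f (\<Oplus>\<^bsub>V\<^esub>t \<in> S. u t)"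
      using insert by (subst V.finsum_insert) (auto simp: additive)
    also have "\<dots> = (\<Oplus>\<^bsub>W\<^esub>t \<in> insert s S. f (u t))"
      using insert by (subst W.finsum_insert) (auto intro!: closed)
    finally show ?case .
  qed
qed

lemma bilinear_formD:
  assumes "bilinear_form K V B"
  shows bilinear_form_closed: "x \<in> carrier V \<Longrightarrow> y \<in> carrier V \<Longrightarrow> B x y \<in> carrier K"
    and bilinear_form_add_left: "x \<in> carrier V \<Longrightarrow> y \<in> carrier V \<Longrightarrow> z \<in> carrier V \<Longrightarrow>
      B (x \<oplus>\<^bsub>V\<^esub> y) z = B x z \<oplus>\<^bsub>K\<^esub> B y z"
    and bilinear_form_add_right: "x \<in> carrier V \<Longrightarrow> y \<in> carrier V \<Longrightarrow> z \<in> carrier V \<Longrightarrow>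
      B x (y \<oplus>\<^bsub>V\<^esub> z) = B x y \<oplus>\<^bsub>K\<^esub> B x z"
    and bilinear_form_smult_left: "c \<in> carrier K \<Longrightarrow> x \<in> carrier V \<Longrightarrow> y \<in> carrier V \<Longrightarrow>
      B (c \<odot>\<^bsub>V\<^esub> x) y = c \<otimes>\<^bsub>K\<^esub> B x y"
    and bilinear_form_smult_right: "c \<in> carrier K \<Longrightarrow> x \<in> carrier V \<Longrightarrow> y \<in> carrier V \<Longrightarrow>
      B x (c \<odot>\<^bsub>V\<^esub> y) = c \<otimes>\<^bsub>K\<^esub> B x y"
  using assms by (simp_all add: bilinear_form_def)

text \<open>The zero vector is \<open>\<zero> \<odot> x\<close>, and the scalar
  \<open>\<zero>\<close> can be pulled out of either argument.\<close>

lemma (in module) bilinear_form_zero: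
  assumes B: "bilinear_form R M B" and x: "x \<in> carrier M"
  shows bilinear_form_zero_left: "B \<zero>\<^bsub>M\<^esub> x = \<zero>"
    and bilinear_form_zero_right: "B x \<zero>\<^bsub>M\<^esub> = \<zero>"
  using bilinear_form_smult_left[OF B R.zero_closed x x]
    bilinear_form_smult_right[OF B R.zero_closed x x] bilinear_form_closed[OF B x x] x
  by simp_all

section \<open>Pure tensors, components and the action on \<open>\<Lambda>\<close>\<close>

context finite_group_algebra_action
begin

interpretation G: group G
  by (rule group_G)

text \<open>For \<open>g\<close> in the group this is the pure tensor of \<open>v\<close> with
  \<open>g\<close>, in the explicit shape given by \<open>tensor_elem\<close>.\<close>

definition single
  where "single g v = (\<lambda>s \<in> carrier G. if s = g then v else \<zero>\<^bsub>\<Lambda>\<^esub>)"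

lemma single_closed: "v \<in> carrier \<Lambda> \<Longrightarrow> single g v \<in> carrier \<Lambda>G"
  by (auto simp: skew_group_algebra_def single_def)

lemma single_apply: "s \<in> carrier G \<Longrightarrow> single g v s = (if s = g then v else \<zero>\<^bsub>\<Lambda>\<^esub>)"
  by (simp add: single_def)

lemma component_closed: "x \<in> carrier \<Lambda>G \<Longrightarrow> g \<in> carrier G \<Longrightarrow> x g \<in> carrier \<Lambda>"
  by (auto simp: skew_group_algebra_def)

lemma act_add:
  "g \<in> carrier G \<Longrightarrow> v \<in> carrier \<Lambda> \<Longrightarrow> w \<in> carrier \<Lambda> \<Longrightarrow>
    \<phi> g (v \<oplus>\<^bsub>\<Lambda>\<^esub> w) = \<phi> g v \<oplus>\<^bsub>\<Lambda>\<^esub> \<phi> g w"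
  using linear by (rule module_hom_add)

lemma act_smult:
  "g \<in> carrier G \<Longrightarrow> c \<in> carrier K \<Longrightarrow> v \<in> carrier \<Lambda> \<Longrightarrow> \<phi> g (c \<odot>\<^bsub>\<Lambda>\<^esub> v) = c \<odot>\<^bsub>\<Lambda>\<^esub> \<phi> g v"
  using linear by (rule module_hom_smult)

lemma act_mult:
  "g \<in> carrier G \<Longrightarrow> v \<in> carrier \<Lambda> \<Longrightarrow> w \<in> carrier \<Lambda> \<Longrightarrow>
    \<phi> g (v \<otimes>\<^bsub>\<Lambda>\<^esub> w) = \<phi> g v \<otimes>\<^bsub>\<Lambda>\<^esub> \<phi> g w"
  using ring_automorphism[of g] by (auto simp: ring_iso_def ring_hom_mult)

lemma act_ring_one: "g \<in> carrier G \<Longrightarrow> \<phi> g \<one>\<^bsub>\<Lambda>\<^esub> = \<one>\<^bsub>\<Lambda>\<^esub>"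
  using ring_automorphism[of g] by (auto simp: ring_iso_def ring_hom_one)

text \<open>The neutral element of the group of bijections is the identity function restricted to
  the carrier, which is why \<open>v\<close> has to lie in \<open>\<Lambda>\<close>.\<close>

lemma act_group_one: "v \<in> carrier \<Lambda> \<Longrightarrow> \<phi> \<one>\<^bsub>G\<^esub> v = v"
  using action.id_eq_one by (metis restrict_apply')

lemma act_finsum:
  assumes "g \<in> carrier G" "u \<in> S \<rightarrow> carrier \<Lambda>"
  shows "\<phi> g (\<Oplus>\<^bsub>\<Lambda>\<^esub>s \<in> S. u s) = (\<Oplus>\<^bsub>\<Lambda>\<^esub>s \<in> S. \<phi> g (u s))"
  using assms
  by (intro finsum_additive) (auto simp: act_closed act_zero act_add M.abelian_monoid_axioms)

section \<open>The product of the skew group algebra and its associativity\<close>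

lemma skew_mult_closed: "x \<in> carrier \<Lambda>G \<Longrightarrow> y \<in> carrier \<Lambda>G \<Longrightarrow> x \<otimes>\<^bsub>\<Lambda>G\<^esub> y \<in> carrier \<Lambda>G"
  by (auto simp: skew_group_algebra_def PiE_iff intro!: M.finsum_closed A.m_closed act_closed)

text \<open>A factorisation of \<open>s\<close> is determined by its first factor \<open>g\<close>,
  the second being \<open>inv g \<otimes> s\<close>. The index set becomes the whole group,
  independent of \<open>s\<close>, so that iterated sums can be interchanged.\<close>

lemma skew_mult_apply:
  assumes x: "x \<in> carrier \<Lambda>G" and y: "y \<in> carrier \<Lambda>G" and s: "s \<in> carrier G"
  shows "(x \<otimes>\<^bsub>\<Lambda>G\<^esub> y) s = (\<Oplus>\<^bsub>\<Lambda>\<^esub>g \<in> carrier G. x g \<otimes>\<^bsub>\<Lambda>\<^esub> \<phi> g (y (inv\<^bsub>G\<^esub> g \<otimes>\<^bsub>G\<^esub> s)))"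
proof -
  have P: "{(g, h) \<in> carrier G \<times> carrier G. g \<otimes>\<^bsub>G\<^esub> h = s}
      = (\<lambda>g. (g, inv\<^bsub>G\<^esub> g \<otimes>\<^bsub>G\<^esub> s)) ` carrier G"
    using s by (auto simp: image_iff G.inv_solve_left' G.m_assoc[symmetric])
  have "(x \<otimes>\<^bsub>\<Lambda>G\<^esub> y) s = finsum \<Lambda> (\<lambda>(g, h). x g \<otimes>\<^bsub>\<Lambda>\<^esub> \<phi> g (y h))
      ((\<lambda>g. (g, inv\<^bsub>G\<^esub> g \<otimes>\<^bsub>G\<^esub> s)) ` carrier G)"
    unfolding P[symmetric] using s by (simp add: skew_group_algebra_def)
  also have "\<dots> = (\<Oplus>\<^bsub>\<Lambda>\<^esub>g \<in> carrier G. x g \<otimes>\<^bsub>\<Lambda>\<^esub> \<phi> g (y (inv\<^bsub>G\<^esub> g \<otimes>\<^bsub>G\<^esub> s)))"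
    using x y s
    by (subst M.finsum_reindex) (auto simp: inj_on_def component_closed act_closed)
  finally show ?thesis .
qed

text \<open>Push \<open>\<phi> g\<close> through the sum and the products, combine
  \<open>\<phi> g\<close> with \<open>\<phi> h\<close> into the action of
  \<open>g \<otimes> h\<close>, and reindex by left translation with \<open>g\<close>. This yields
  the inner sum of a product bracketed to the right, in the form that \<open>skew_mult_assoc\<close>
  compares.\<close>

lemma act_skew_mult_apply:
  assumes x: "x \<in> carrier \<Lambda>G" and y: "y \<in> carrier \<Lambda>G"
    and g: "g \<in> carrier G" and s: "s \<in> carrier G"
  shows "\<phi> g ((x \<otimes>\<^bsub>\<Lambda>G\<^esub> y) (inv\<^bsub>G\<^esub> g \<otimes>\<^bsub>G\<^esub> s))
    = (\<Oplus>\<^bsub>\<Lambda>\<^esub>h \<in> carrier G.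
        \<phi> g (x (inv\<^bsub>G\<^esub> g \<otimes>\<^bsub>G\<^esub> h)) \<otimes>\<^bsub>\<Lambda>\<^esub> \<phi> h (y (inv\<^bsub>G\<^esub> h \<otimes>\<^bsub>G\<^esub> s)))"
proof -
  let ?f = "\<lambda>h. \<phi> g (x (inv\<^bsub>G\<^esub> g \<otimes>\<^bsub>G\<^esub> h)) \<otimes>\<^bsub>\<Lambda>\<^esub> \<phi> h (y (inv\<^bsub>G\<^esub> h \<otimes>\<^bsub>G\<^esub> s))"
  have img: "(\<lambda>h. g \<otimes>\<^bsub>G\<^esub> h) ` carrier G = carrier G"
    using g by (rule G.surj_const_mult)
  have cancel: "inv\<^bsub>G\<^esub> g \<otimes>\<^bsub>G\<^esub> (g \<otimes>\<^bsub>G\<^esub> h) = h" if "h \<in> carrier G" for h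
    using g that by (simp add: G.m_assoc[symmetric])
  have "\<phi> g ((x \<otimes>\<^bsub>\<Lambda>G\<^esub> y) (inv\<^bsub>G\<^esub> g \<otimes>\<^bsub>G\<^esub> s))
      = (\<Oplus>\<^bsub>\<Lambda>\<^esub>h \<in> carrier G.
          \<phi> g (x h \<otimes>\<^bsub>\<Lambda>\<^esub> \<phi> h (y (inv\<^bsub>G\<^esub> h \<otimes>\<^bsub>G\<^esub> (inv\<^bsub>G\<^esub> g \<otimes>\<^bsub>G\<^esub> s)))))"
    using x y g s
    by (simp add: skew_mult_apply) (intro act_finsum; auto simp: component_closed act_closed)
  \<comment> \<open>The summands are now expressed through \<open>g \<otimes> h\<close>:
    \<open>inv g \<otimes> (g \<otimes> h)\<close> is \<open>h\<close>, and
    \<open>inv (g \<otimes> h)\<close> is \<open>inv h \<otimes> inv g\<close>.\<close>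
  also have "\<dots> = (\<Oplus>\<^bsub>\<Lambda>\<^esub>h \<in> carrier G. ?f (g \<otimes>\<^bsub>G\<^esub> h))"
    using x y g s
    by (intro M.finsum_cong')
      (auto simp: component_closed act_closed act_mult G.inv_mult_group G.m_assoc
        action.composition_rule cancel)
  also have "\<dots> = (\<Oplus>\<^bsub>\<Lambda>\<^esub>h \<in> carrier G. ?f h)"
    using x y g s M.finsum_reindex[of ?f "\<lambda>h. g \<otimes>\<^bsub>G\<^esub> h" "carrier G"]
    by (simp add: img Pi_def component_closed act_closed inj_on_def)
  finally show ?thesis .
qed

text \<open>Elements of the carrier are extensional functions, so they all agree outside the
  group.\<close>

lemma skew_eqI:
  assumes "x \<in> carrier \<Lambda>G" "y \<in> carrier \<Lambda>G" "\<And>s. s \<in> carrier G \<Longrightarrow> x s = y s"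
  shows "x = y"
  using assms by (auto simp: skew_group_algebra_def intro: PiE_ext)

text \<open>Both bracketings are the same double sum: \<open>g\<close> is the group part taken from
  \<open>x\<close>, and \<open>h\<close> is the product of the group parts taken from
  \<open>x\<close> and \<open>y\<close>. Only the order of summation differs.\<close>

lemma skew_mult_assoc:
  assumes x: "x \<in> carrier \<Lambda>G" and y: "y \<in> carrier \<Lambda>G" and z: "z \<in> carrier \<Lambda>G"
  shows "(x \<otimes>\<^bsub>\<Lambda>G\<^esub> y) \<otimes>\<^bsub>\<Lambda>G\<^esub> z = x \<otimes>\<^bsub>\<Lambda>G\<^esub> (y \<otimes>\<^bsub>\<Lambda>G\<^esub> z)"
proof (rule skew_eqI)
  fix s assume s: "s \<in> carrier G"
  let ?a = "\<lambda>g h. \<phi> g (y (inv\<^bsub>G\<^esub> g \<otimes>\<^bsub>G\<^esub> h))"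
  let ?b = "\<lambda>h. \<phi> h (z (inv\<^bsub>G\<^esub> h \<otimes>\<^bsub>G\<^esub> s))"
  have a: "?a g h \<in> carrier \<Lambda>" if "g \<in> carrier G" "h \<in> carrier G" for g h
    using y that by (simp add: component_closed act_closed)
  have b: "?b h \<in> carrier \<Lambda>" if "h \<in> carrier G" for h
    using z s that by (simp add: component_closed act_closed)
  note closed = a b component_closed[OF x]
  have "((x \<otimes>\<^bsub>\<Lambda>G\<^esub> y) \<otimes>\<^bsub>\<Lambda>G\<^esub> z) s
      = (\<Oplus>\<^bsub>\<Lambda>\<^esub>h \<in> carrier G. (\<Oplus>\<^bsub>\<Lambda>\<^esub>g \<in> carrier G. x g \<otimes>\<^bsub>\<Lambda>\<^esub> ?a g h) \<otimes>\<^bsub>\<Lambda>\<^esub> ?b h)"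
    using x y z s
    by (subst skew_mult_apply)
      (auto simp: skew_mult_closed skew_mult_apply closed intro!: M.finsum_cong' M.finsum_closed)
  also have "\<dots> = (\<Oplus>\<^bsub>\<Lambda>\<^esub>h \<in> carrier G. \<Oplus>\<^bsub>\<Lambda>\<^esub>g \<in> carrier G. x g \<otimes>\<^bsub>\<Lambda>\<^esub> (?a g h \<otimes>\<^bsub>\<Lambda>\<^esub> ?b h))"
    using finite_group
    by (intro M.finsum_cong' refl)
      (auto simp: A.finsum_ldistr closed A.m_assoc intro!: M.finsum_cong' M.finsum_closed)
  \<comment> \<open>Bracketing to the left has \<open>h\<close> as the outer index, bracketing to
    the right has \<open>g\<close>.\<close>
  also have "\<dots> = (\<Oplus>\<^bsub>\<Lambda>\<^esub>g \<in> carrier G. \<Oplus>\<^bsub>\<Lambda>\<^esub>h \<in> carrier G. x g \<otimes>\<^bsub>\<Lambda>\<^esub> (?a g h \<otimes>\<^bsub>\<Lambda>\<^esub> ?b h))"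
    by (rule A.finsum_finsum_swap) (auto simp: closed finite_group)
  also have "\<dots> = (\<Oplus>\<^bsub>\<Lambda>\<^esub>g \<in> carrier G. x g \<otimes>\<^bsub>\<Lambda>\<^esub> (\<Oplus>\<^bsub>\<Lambda>\<^esub>h \<in> carrier G. ?a g h \<otimes>\<^bsub>\<Lambda>\<^esub> ?b h))"
    using finite_group
    by (intro M.finsum_cong' refl)
      (auto simp: A.finsum_rdistr closed intro!: M.finsum_cong' M.finsum_closed)
  also have "\<dots> = (x \<otimes>\<^bsub>\<Lambda>G\<^esub> (y \<otimes>\<^bsub>\<Lambda>G\<^esub> z)) s"
    using x y z s
    by (subst skew_mult_apply)
      (auto simp: skew_mult_closed act_skew_mult_apply closed
        intro!: M.finsum_cong' M.finsum_closed)
  finally show "((x \<otimes>\<^bsub>\<Lambda>G\<^esub> y) \<otimes>\<^bsub>\<Lambda>G\<^esub> z) s = (x \<otimes>\<^bsub>\<Lambda>G\<^esub> (y \<otimes>\<^bsub>\<Lambda>G\<^esub> z)) s" .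
qed (simp_all add: x y z skew_mult_closed)

section \<open>The module and ring structure of the skew group algebra\<close>

lemma skew_abelian_group: "abelian_group \<Lambda>G"
proof (rule abelian_groupI)
  fix x assume x: "x \<in> carrier \<Lambda>G"
  have "(\<lambda>s \<in> carrier G. \<ominus>\<^bsub>\<Lambda>\<^esub> x s) \<in> carrier \<Lambda>G"
    using x by (auto simp: skew_group_algebra_def)
  moreover have "(\<lambda>s \<in> carrier G. \<ominus>\<^bsub>\<Lambda>\<^esub> x s) \<oplus>\<^bsub>\<Lambda>G\<^esub> x = \<zero>\<^bsub>\<Lambda>G\<^esub>"
    using component_closed[OF x]
    by (auto simp: skew_group_algebra_def M.l_neg intro!: restrict_ext)
  ultimately show "\<exists>y \<in> carrier \<Lambda>G. y \<oplus>\<^bsub>\<Lambda>G\<^esub> x = \<zero>\<^bsub>\<Lambda>G\<^esub>" by blast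
next
  fix x assume x: "x \<in> carrier \<Lambda>G"
  show "\<zero>\<^bsub>\<Lambda>G\<^esub> \<oplus>\<^bsub>\<Lambda>G\<^esub> x = x"
    by (rule skew_eqI) (use x in \<open>auto simp: skew_group_algebra_def PiE_iff\<close>)
qed (auto simp: skew_group_algebra_def PiE_iff M.a_ac intro!: restrict_ext)

lemma skew_add_apply: "s \<in> carrier G \<Longrightarrow> (x \<oplus>\<^bsub>\<Lambda>G\<^esub> y) s = x s \<oplus>\<^bsub>\<Lambda>\<^esub> y s"
  by (simp add: skew_group_algebra_def)

lemma skew_smult_apply: "s \<in> carrier G \<Longrightarrow> (c \<odot>\<^bsub>\<Lambda>G\<^esub> x) s = c \<odot>\<^bsub>\<Lambda>\<^esub> x s"
  by (simp add: skew_group_algebra_def)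

lemma skew_zero_apply: "s \<in> carrier G \<Longrightarrow> \<zero>\<^bsub>\<Lambda>G\<^esub> s = \<zero>\<^bsub>\<Lambda>\<^esub>"
  by (simp add: skew_group_algebra_def)

lemma skew_one: "\<one>\<^bsub>\<Lambda>G\<^esub> = single \<one>\<^bsub>G\<^esub> \<one>\<^bsub>\<Lambda>\<^esub>"
  by (simp add: skew_group_algebra_def single_def)

lemma skew_module: "module K \<Lambda>G"
  by (rule moduleI[OF R.cring_axioms skew_abelian_group])
    (auto simp: skew_group_algebra_def PiE_iff smult_l_distr
      smult_r_distr smult_assoc1 extensional_def fun_eq_iff)

lemma skew_smult_closed: "c \<in> carrier K \<Longrightarrow> x \<in> carrier \<Lambda>G \<Longrightarrow> c \<odot>\<^bsub>\<Lambda>G\<^esub> x \<in> carrier \<Lambda>G"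
  by (rule Module.module.smult_closed[OF skew_module])

lemma skew_add_closed: "x \<in> carrier \<Lambda>G \<Longrightarrow> y \<in> carrier \<Lambda>G \<Longrightarrow> x \<oplus>\<^bsub>\<Lambda>G\<^esub> y \<in> carrier \<Lambda>G"
  using skew_abelian_group by (rule abelian_groupE)

lemma skew_ring: "ring \<Lambda>G"
proof (intro ringI skew_abelian_group monoidI)
  show "\<one>\<^bsub>\<Lambda>G\<^esub> \<in> carrier \<Lambda>G"
    by (simp add: skew_one single_closed)
next
  fix x assume x: "x \<in> carrier \<Lambda>G"
  show "\<one>\<^bsub>\<Lambda>G\<^esub> \<otimes>\<^bsub>\<Lambda>G\<^esub> x = x"
  proof (rule skew_eqI)
    fix s assume s: "s \<in> carrier G"
    \<comment> \<open>Only the neutral \<open>g\<close> contributes. There the summand is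
      \<open>x s\<close>, so it is written without \<open>g\<close>, in the form that
      \<open>finsum_singleton\<close> evaluates with a constant function.\<close>
    have "(\<one>\<^bsub>\<Lambda>G\<^esub> \<otimes>\<^bsub>\<Lambda>G\<^esub> x) s = (\<Oplus>\<^bsub>\<Lambda>\<^esub>g \<in> carrier G. if \<one>\<^bsub>G\<^esub> = g then x s else \<zero>\<^bsub>\<Lambda>\<^esub>)"
      using x s unfolding skew_one
      by (subst skew_mult_apply)
        (auto simp: single_closed single_apply component_closed act_closed act_group_one
          intro!: M.finsum_cong')
    also have "\<dots> = x s"
      using x s finite_group
      by (subst M.finsum_singleton[where f = "\<lambda>_. x s"]) (auto simp: component_closed)
    finally show "(\<one>\<^bsub>\<Lambda>G\<^esub> \<otimes>\<^bsub>\<Lambda>G\<^esub> x) s = x s" .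
  qed (simp_all add: x skew_mult_closed skew_one single_closed)
  show "x \<otimes>\<^bsub>\<Lambda>G\<^esub> \<one>\<^bsub>\<Lambda>G\<^esub> = x"
  proof (rule skew_eqI)
    fix s assume s: "s \<in> carrier G"
    \<comment> \<open>Multiplying by the unit on the right leaves only the summand with
      \<open>g = s\<close>.\<close>
    have eq: "inv\<^bsub>G\<^esub> g \<otimes>\<^bsub>G\<^esub> s = \<one>\<^bsub>G\<^esub> \<longleftrightarrow> s = g" if "g \<in> carrier G" for g
      using s that by (simp add: G.inv_solve_left')
    have "(x \<otimes>\<^bsub>\<Lambda>G\<^esub> \<one>\<^bsub>\<Lambda>G\<^esub>) s = (\<Oplus>\<^bsub>\<Lambda>\<^esub>g \<in> carrier G. if s = g then x g else \<zero>\<^bsub>\<Lambda>\<^esub>)"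
      using x s unfolding skew_one
      by (subst skew_mult_apply)
        (auto simp: single_closed single_apply component_closed act_closed act_ring_one act_zero eq
          intro!: M.finsum_cong')
    also have "\<dots> = x s"
      using x s finite_group by (subst M.finsum_singleton) (auto simp: component_closed)
    finally show "(x \<otimes>\<^bsub>\<Lambda>G\<^esub> \<one>\<^bsub>\<Lambda>G\<^esub>) s = x s" .
  qed (simp_all add: x skew_mult_closed skew_one single_closed)
next
  fix x y z assume xyz: "x \<in> carrier \<Lambda>G" "y \<in> carrier \<Lambda>G" "z \<in> carrier \<Lambda>G"
  note closed = skew_mult_closed skew_add_closed component_closed act_closed
  show "(x \<oplus>\<^bsub>\<Lambda>G\<^esub> y) \<otimes>\<^bsub>\<Lambda>G\<^esub> z = x \<otimes>\<^bsub>\<Lambda>G\<^esub> z \<oplus>\<^bsub>\<Lambda>G\<^esub> y \<otimes>\<^bsub>\<Lambda>G\<^esub> z"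
  proof (rule skew_eqI)
    fix s assume s: "s \<in> carrier G"
    let ?t = "\<lambda>g. inv\<^bsub>G\<^esub> g \<otimes>\<^bsub>G\<^esub> s"
    have "((x \<oplus>\<^bsub>\<Lambda>G\<^esub> y) \<otimes>\<^bsub>\<Lambda>G\<^esub> z) s
        = (\<Oplus>\<^bsub>\<Lambda>\<^esub>g \<in> carrier G. x g \<otimes>\<^bsub>\<Lambda>\<^esub> \<phi> g (z (?t g)) \<oplus>\<^bsub>\<Lambda>\<^esub> y g \<otimes>\<^bsub>\<Lambda>\<^esub> \<phi> g (z (?t g)))"
      using xyz s
      by (simp only: skew_mult_apply skew_add_closed)
        (intro M.finsum_cong'; simp add: closed skew_add_apply A.l_distr)
    also have "\<dots> = (\<Oplus>\<^bsub>\<Lambda>\<^esub>g \<in> carrier G. x g \<otimes>\<^bsub>\<Lambda>\<^esub> \<phi> g (z (?t g))) \<oplus>\<^bsub>\<Lambda>\<^esub> (\<Oplus>\<^bsub>\<Lambda>\<^esub>g \<in> carrier G. y g \<otimes>\<^bsub>\<Lambda>\<^esub> \<phi> g (z (?t g)))"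
      using xyz s by (intro M.finsum_addf Pi_I) (simp_all add: closed)
    also have "\<dots> = (x \<otimes>\<^bsub>\<Lambda>G\<^esub> z \<oplus>\<^bsub>\<Lambda>G\<^esub> y \<otimes>\<^bsub>\<Lambda>G\<^esub> z) s"
      using xyz s by (simp add: skew_add_apply skew_mult_apply)
    finally show "((x \<oplus>\<^bsub>\<Lambda>G\<^esub> y) \<otimes>\<^bsub>\<Lambda>G\<^esub> z) s = (x \<otimes>\<^bsub>\<Lambda>G\<^esub> z \<oplus>\<^bsub>\<Lambda>G\<^esub> y \<otimes>\<^bsub>\<Lambda>G\<^esub> z) s" .
  qed (simp_all add: closed xyz)
  show "z \<otimes>\<^bsub>\<Lambda>G\<^esub> (x \<oplus>\<^bsub>\<Lambda>G\<^esub> y) = z \<otimes>\<^bsub>\<Lambda>G\<^esub> x \<oplus>\<^bsub>\<Lambda>G\<^esub> z \<otimes>\<^bsub>\<Lambda>G\<^esub> y"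
  proof (rule skew_eqI)
    fix s assume s: "s \<in> carrier G"
    let ?t = "\<lambda>g. inv\<^bsub>G\<^esub> g \<otimes>\<^bsub>G\<^esub> s"
    have "(z \<otimes>\<^bsub>\<Lambda>G\<^esub> (x \<oplus>\<^bsub>\<Lambda>G\<^esub> y)) s
        = (\<Oplus>\<^bsub>\<Lambda>\<^esub>g \<in> carrier G. z g \<otimes>\<^bsub>\<Lambda>\<^esub> \<phi> g (x (?t g)) \<oplus>\<^bsub>\<Lambda>\<^esub> z g \<otimes>\<^bsub>\<Lambda>\<^esub> \<phi> g (y (?t g)))"
      using xyz s
      by (simp only: skew_mult_apply skew_add_closed)
        (intro M.finsum_cong'; simp add: closed skew_add_apply act_add A.r_distr)
    also have "\<dots> = (\<Oplus>\<^bsub>\<Lambda>\<^esub>g \<in> carrier G. z g \<otimes>\<^bsub>\<Lambda>\<^esub> \<phi> g (x (?t g))) \<oplus>\<^bsub>\<Lambda>\<^esub> (\<Oplus>\<^bsub>\<Lambda>\<^esub>g \<in> carrier G. z g \<otimes>\<^bsub>\<Lambda>\<^esub> \<phi> g (y (?t g)))"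
      using xyz s by (intro M.finsum_addf Pi_I) (simp_all add: closed)
    also have "\<dots> = (z \<otimes>\<^bsub>\<Lambda>G\<^esub> x \<oplus>\<^bsub>\<Lambda>G\<^esub> z \<otimes>\<^bsub>\<Lambda>G\<^esub> y) s"
      using xyz s by (simp add: skew_add_apply skew_mult_apply)
    finally show "(z \<otimes>\<^bsub>\<Lambda>G\<^esub> (x \<oplus>\<^bsub>\<Lambda>G\<^esub> y)) s = (z \<otimes>\<^bsub>\<Lambda>G\<^esub> x \<oplus>\<^bsub>\<Lambda>G\<^esub> z \<otimes>\<^bsub>\<Lambda>G\<^esub> y) s" .
  qed (simp_all add: closed xyz)
qed (simp_all add: skew_mult_closed skew_mult_assoc)

lemma skew_smult_mult:
  assumes c: "c \<in> carrier K" and x: "x \<in> carrier \<Lambda>G" and y: "y \<in> carrier \<Lambda>G"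
  shows skew_smult_mult_left: "(c \<odot>\<^bsub>\<Lambda>G\<^esub> x) \<otimes>\<^bsub>\<Lambda>G\<^esub> y = c \<odot>\<^bsub>\<Lambda>G\<^esub> (x \<otimes>\<^bsub>\<Lambda>G\<^esub> y)"
    and skew_smult_mult_right: "x \<otimes>\<^bsub>\<Lambda>G\<^esub> (c \<odot>\<^bsub>\<Lambda>G\<^esub> y) = c \<odot>\<^bsub>\<Lambda>G\<^esub> (x \<otimes>\<^bsub>\<Lambda>G\<^esub> y)"
proof -
  note closed = skew_mult_closed skew_smult_closed component_closed act_closed
  show "(c \<odot>\<^bsub>\<Lambda>G\<^esub> x) \<otimes>\<^bsub>\<Lambda>G\<^esub> y = c \<odot>\<^bsub>\<Lambda>G\<^esub> (x \<otimes>\<^bsub>\<Lambda>G\<^esub> y)"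
  proof (rule skew_eqI)
    fix s assume s: "s \<in> carrier G"
    let ?f = "\<lambda>g. x g \<otimes>\<^bsub>\<Lambda>\<^esub> \<phi> g (y (inv\<^bsub>G\<^esub> g \<otimes>\<^bsub>G\<^esub> s))"
    have "((c \<odot>\<^bsub>\<Lambda>G\<^esub> x) \<otimes>\<^bsub>\<Lambda>G\<^esub> y) s = (\<Oplus>\<^bsub>\<Lambda>\<^esub>g \<in> carrier G. c \<odot>\<^bsub>\<Lambda>\<^esub> ?f g)"
      using c x y s
      by (simp only: skew_mult_apply skew_smult_closed)
        (intro M.finsum_cong'; simp add: closed skew_smult_apply smult_mult_left)
    also have "\<dots> = c \<odot>\<^bsub>\<Lambda>\<^esub> (\<Oplus>\<^bsub>\<Lambda>\<^esub>g \<in> carrier G. ?f g)"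
      using c x y s by (intro finsum_smult[symmetric] Pi_I) (simp_all add: closed)
    also have "\<dots> = (c \<odot>\<^bsub>\<Lambda>G\<^esub> (x \<otimes>\<^bsub>\<Lambda>G\<^esub> y)) s"
      using x y s by (simp add: skew_smult_apply skew_mult_apply)
    finally show "((c \<odot>\<^bsub>\<Lambda>G\<^esub> x) \<otimes>\<^bsub>\<Lambda>G\<^esub> y) s = (c \<odot>\<^bsub>\<Lambda>G\<^esub> (x \<otimes>\<^bsub>\<Lambda>G\<^esub> y)) s" .
  qed (simp_all add: closed c x y)
  show "x \<otimes>\<^bsub>\<Lambda>G\<^esub> (c \<odot>\<^bsub>\<Lambda>G\<^esub> y) = c \<odot>\<^bsub>\<Lambda>G\<^esub> (x \<otimes>\<^bsub>\<Lambda>G\<^esub> y)"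
  proof (rule skew_eqI)
    fix s assume s: "s \<in> carrier G"
    let ?f = "\<lambda>g. x g \<otimes>\<^bsub>\<Lambda>\<^esub> \<phi> g (y (inv\<^bsub>G\<^esub> g \<otimes>\<^bsub>G\<^esub> s))"
    have "(x \<otimes>\<^bsub>\<Lambda>G\<^esub> (c \<odot>\<^bsub>\<Lambda>G\<^esub> y)) s = (\<Oplus>\<^bsub>\<Lambda>\<^esub>g \<in> carrier G. c \<odot>\<^bsub>\<Lambda>\<^esub> ?f g)"
      using c x y s
      by (simp only: skew_mult_apply skew_smult_closed)
        (intro M.finsum_cong'; simp add: closed skew_smult_apply act_smult smult_mult_right)
    also have "\<dots> = c \<odot>\<^bsub>\<Lambda>\<^esub> (\<Oplus>\<^bsub>\<Lambda>\<^esub>g \<in> carrier G. ?f g)"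
      using c x y s by (intro finsum_smult[symmetric] Pi_I) (simp_all add: closed)
    also have "\<dots> = (c \<odot>\<^bsub>\<Lambda>G\<^esub> (x \<otimes>\<^bsub>\<Lambda>G\<^esub> y)) s"
      using x y s by (simp add: skew_smult_apply skew_mult_apply)
    finally show "(x \<otimes>\<^bsub>\<Lambda>G\<^esub> (c \<odot>\<^bsub>\<Lambda>G\<^esub> y)) s = (c \<odot>\<^bsub>\<Lambda>G\<^esub> (x \<otimes>\<^bsub>\<Lambda>G\<^esub> y)) s" .
  qed (simp_all add: closed c x y)
qed

section \<open>Finite dimension of the skew group algebra\<close>

lemma skew_vectorspace: "vectorspace K \<Lambda>G"
  by (intro vectorspace.intro skew_module field_axioms)

text \<open>Linearity makes the preimage of a subspace under \<open>single g\<close> a subspace, as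
  used in \<open>skew_fin_dim\<close>.\<close>

lemma single_module_hom: "single g \<in> module_hom K \<Lambda> \<Lambda>G"
  by (auto simp: module_hom_def single_closed)
    (auto simp: single_def skew_group_algebra_def intro!: restrict_ext)

text \<open>This is \<open>hom_expand_sum\<close> for the identity map.\<close>

lemma skew_expand:
  assumes "x \<in> carrier \<Lambda>G"
  shows "x = (\<Oplus>\<^bsub>\<Lambda>G\<^esub>g \<in> carrier G. single g (x g))"
  unfolding single_def
  using assms
  by (intro hom_expand_sum[where T = "\<lambda>x. x" and C = "carrier \<Lambda>" and pl = "add \<Lambda>"]
      skew_abelian_group finite_group)
    (auto simp: skew_group_algebra_def)

text \<open>If a finite set \<open>X\<close> spans \<open>\<Lambda>\<close>, the pure tensors of its
  members with group elements span the skew group algebra. A finite generating set suffices for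
  \<open>fin_dim\<close>, so linear independence is never discussed.\<close>

lemma skew_fin_dim: "vectorspace.fin_dim K \<Lambda>G"
proof -
  interpret S: vectorspace K \<Lambda>G by (rule skew_vectorspace)
  obtain X where X: "finite X" "X \<subseteq> carrier \<Lambda>" "gen_set X"
    using finite_dimensional by (auto simp: fin_dim_def)
  define Y where "Y = (\<lambda>(g, v). single g v) ` (carrier G \<times> X)"
  have Y: "Y \<subseteq> carrier \<Lambda>G"
    using X(2) by (auto simp: Y_def single_closed)
  interpret N: submodule K "S.span Y" \<Lambda>G
    by (rule S.span_is_submodule[OF Y])
  have single_span: "single g v \<in> S.span Y" if g: "g \<in> carrier G" and v: "v \<in> carrier \<Lambda>" for g v
  proof -
    interpret H: mod_hom K \<Lambda> \<Lambda>G "single g"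
      by (intro mod_hom.intro mod_hom_axioms.intro single_module_hom module_axioms skew_module)
    \<comment> \<open>The vectors sent into the span by \<open>single g\<close> form a submodule
      containing \<open>X\<close>, hence all of \<open>\<Lambda>\<close>. This avoids handling
      linear combinations.\<close>
    have "submodule K {v \<in> carrier \<Lambda>. single g v \<in> S.span Y} \<Lambda>"
      by (intro submodule.intro) (auto simp: module_axioms)
    moreover have "X \<subseteq> {v \<in> carrier \<Lambda>. single g v \<in> S.span Y}"
      using X(2) g S.in_own_span[OF Y] by (auto simp: Y_def)
    ultimately show ?thesis
      using span_is_subset X(3) v by blast
  qed
  have "x \<in> S.span Y" if x: "x \<in> carrier \<Lambda>G" for x
  proof -
    have "(\<Oplus>\<^bsub>\<Lambda>G\<^esub>g \<in> R. single g (x g)) \<in> S.span Y" if "finite R" "R \<subseteq> carrier G" for R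
      using that
    proof (induction R)
      case (insert g R)
      then show ?case using x
        by (subst S.finsum_insert) (auto simp: single_closed component_closed single_span)
    qed simp
    from this[OF finite_group subset_refl] show ?thesis
      by (simp only: skew_expand[OF x, symmetric])
  qed
  then have "S.gen_set Y"
    using S.span_is_subset2[OF Y] by blast
  moreover have "finite Y"
    by (simp add: Y_def finite_group X(1))
  ultimately show ?thesis
    using Y by (auto simp: S.fin_dim_def)
qed

lemma skew_fd_algebra: "fd_algebra K \<Lambda>G"
  by (intro fd_algebra.intro fd_algebra_axioms.intro skew_vectorspace skew_ring skew_fin_dim
      skew_smult_mult)

section \<open>The skew form as a functional of the product\<close>

text \<open>The group form vanishes unless \<open>m\<close> is the inverse of \<open>l\<close>, so
  the inner sum collapses to one term.\<close>

lemma skew_form_eq: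
  assumes B: "bilinear_form K \<Lambda> B" and x: "x \<in> carrier \<Lambda>G" and y: "y \<in> carrier \<Lambda>G"
  shows "skew_form K G \<phi> B x y = (\<Oplus>l \<in> carrier G. B (x l) (\<phi> l (y (inv\<^bsub>G\<^esub> l))))"
proof -
  have Bc: "B (x l) (\<phi> l (y m)) \<in> carrier K" if "l \<in> carrier G" "m \<in> carrier G" for l m
    using that x y by (intro bilinear_form_closed[OF B] act_closed component_closed)
  have "(\<Oplus>m \<in> carrier G. B (x l) (\<phi> l (y m)) \<otimes> group_form K G (elem l) (elem m))
      = B (x l) (\<phi> l (y (inv\<^bsub>G\<^esub> l)))" if l: "l \<in> carrier G" for l
  proof -
    \<comment> \<open>The condition \<open>l = inv m\<close> of \<open>group_form_elem\<close> is
      turned into \<open>inv l = m\<close> to match \<open>finsum_singleton\<close>.\<close>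
    have "(\<Oplus>m \<in> carrier G. B (x l) (\<phi> l (y m)) \<otimes> group_form K G (elem l) (elem m))
        = (\<Oplus>m \<in> carrier G. if inv\<^bsub>G\<^esub> l = m then B (x l) (\<phi> l (y m)) else \<zero>)"
      using l Bc by (intro R.finsum_cong') (auto simp: group_form_elem)
    also have "\<dots> = B (x l) (\<phi> l (y (inv\<^bsub>G\<^esub> l)))"
      using l Bc finite_group by (subst R.finsum_singleton) auto
    finally show ?thesis .
  qed
  then show ?thesis
    unfolding skew_form_def using Bc by (intro R.finsum_cong') auto
qed

text \<open>Each summand of \<open>skew_form_eq\<close> is \<open>B \<one>\<close> applied to a
  product, and additivity of \<open>B \<one>\<close> moves the sum inside. What remains is
  \<open>skew_mult_apply\<close> at the neutral element.\<close>

lemma skew_form_functional: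
  assumes B: "bilinear_form K \<Lambda> B" "multiplicative_form \<Lambda> B"
    and x: "x \<in> carrier \<Lambda>G" and y: "y \<in> carrier \<Lambda>G"
  shows "skew_form K G \<phi> B x y = B \<one>\<^bsub>\<Lambda>\<^esub> ((x \<otimes>\<^bsub>\<Lambda>G\<^esub> y) \<one>\<^bsub>G\<^esub>)"
proof -
  \<comment> \<open>Multiplicativity with first argument \<open>\<one>\<close>.\<close>
  have B1: "B v w = B \<one>\<^bsub>\<Lambda>\<^esub> (v \<otimes>\<^bsub>\<Lambda>\<^esub> w)" if "v \<in> carrier \<Lambda>" "w \<in> carrier \<Lambda>" for v w
    using B(2) that by (simp add: multiplicative_form_def)
  have "skew_form K G \<phi> B x y
      = (\<Oplus>l \<in> carrier G. B \<one>\<^bsub>\<Lambda>\<^esub> (x l \<otimes>\<^bsub>\<Lambda>\<^esub> \<phi> l (y (inv\<^bsub>G\<^esub> l))))"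
    unfolding skew_form_eq[OF B(1) x y] using x y
    by (intro R.finsum_cong')
      (auto simp: component_closed act_closed intro!: B1 bilinear_form_closed[OF B(1)])
  also have "\<dots> = B \<one>\<^bsub>\<Lambda>\<^esub> (\<Oplus>\<^bsub>\<Lambda>\<^esub>l \<in> carrier G. x l \<otimes>\<^bsub>\<Lambda>\<^esub> \<phi> l (y (inv\<^bsub>G\<^esub> l)))"
    using x y
    by (intro finsum_additive[symmetric])
      (auto simp: component_closed act_closed R.abelian_monoid_axioms M.abelian_monoid_axioms
        bilinear_form_zero_right[OF B(1)] bilinear_form_add_right[OF B(1)]
        intro!: bilinear_form_closed[OF B(1)])
  also have "(\<Oplus>\<^bsub>\<Lambda>\<^esub>l \<in> carrier G. x l \<otimes>\<^bsub>\<Lambda>\<^esub> \<phi> l (y (inv\<^bsub>G\<^esub> l))) = (x \<otimes>\<^bsub>\<Lambda>G\<^esub> y) \<one>\<^bsub>G\<^esub>"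
    using x y
    by (subst skew_mult_apply) (auto simp: component_closed act_closed intro!: M.finsum_cong')
  finally show ?thesis .
qed

text \<open>Through \<open>skew_form_functional\<close> both arguments enter via the product, so
  linearity in either one follows from bilinearity of the product and linearity of \<open>B\<close>
  in its second argument.\<close>

lemma skew_form_bilinear:
  assumes B: "bilinear_form K \<Lambda> B" "multiplicative_form \<Lambda> B"
  shows "bilinear_form K \<Lambda>G (skew_form K G \<phi> B)"
proof -
  interpret S: ring \<Lambda>G by (rule skew_ring)
  show ?thesis
    unfolding bilinear_form_def
    by (simp add: skew_form_functional[OF B] skew_mult_closed skew_add_closed skew_smult_closed
        skew_smult_mult S.l_distr S.r_distr skew_add_apply skew_smult_apply component_closed
        bilinear_form_closed[OF B(1)] bilinear_form_add_right[OF B(1)]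
        bilinear_form_smult_right[OF B(1)])
qed

lemma skew_form_multiplicative:
  assumes B: "bilinear_form K \<Lambda> B" "multiplicative_form \<Lambda> B"
  shows "multiplicative_form \<Lambda>G (skew_form K G \<phi> B)"
  by (auto simp: multiplicative_form_def skew_form_functional[OF B] skew_mult_closed
      skew_mult_assoc)

section \<open>Pairing with pure tensors and nondegeneracy\<close>

text \<open>Of the sum in \<open>skew_form_eq\<close> only \<open>l = g\<close> survives, which
  isolates the component of \<open>y\<close> at \<open>inv g\<close>.\<close>

lemma skew_form_single_left:
  assumes B: "bilinear_form K \<Lambda> B" and v: "v \<in> carrier \<Lambda>" and y: "y \<in> carrier \<Lambda>G"
    and g: "g \<in> carrier G"
  shows "skew_form K G \<phi> B (single g v) y = B v (\<phi> g (y (inv\<^bsub>G\<^esub> g)))"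
proof -
  have c: "B v (\<phi> l (y (inv\<^bsub>G\<^esub> l))) \<in> carrier K" if "l \<in> carrier G" for l
    using that v y by (simp add: bilinear_form_closed[OF B] act_closed component_closed)
  have "skew_form K G \<phi> B (single g v) y
      = (\<Oplus>l \<in> carrier G. if g = l then B v (\<phi> l (y (inv\<^bsub>G\<^esub> l))) else \<zero>)"
    unfolding skew_form_eq[OF B single_closed[OF v] y]
    using c y
    by (intro R.finsum_cong')
      (auto simp: single_apply bilinear_form_zero_left[OF B] component_closed act_closed)
  also have "\<dots> = B v (\<phi> g (y (inv\<^bsub>G\<^esub> g)))"
    using g c finite_group by (subst R.finsum_singleton) auto
  finally show ?thesis .
qed

text \<open>The second argument is evaluated at \<open>inv l\<close>; supporting it at
  \<open>inv g\<close> therefore selects \<open>l = g\<close> and isolates the component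
  \<open>x g\<close>.\<close>

lemma skew_form_single_right:
  assumes B: "bilinear_form K \<Lambda> B" and x: "x \<in> carrier \<Lambda>G" and w: "w \<in> carrier \<Lambda>"
    and g: "g \<in> carrier G"
  shows "skew_form K G \<phi> B x (single (inv\<^bsub>G\<^esub> g) w) = B (x g) (\<phi> g w)"
proof -
  have c: "B (x l) (\<phi> l w) \<in> carrier K" if "l \<in> carrier G" for l
    using that x w by (simp add: bilinear_form_closed[OF B] act_closed component_closed)
  have "skew_form K G \<phi> B x (single (inv\<^bsub>G\<^esub> g) w)
      = (\<Oplus>l \<in> carrier G. if g = l then B (x l) (\<phi> l w) else \<zero>)"
    unfolding skew_form_eq[OF B x single_closed[OF w]]
    using c x g
    by (intro R.finsum_cong')
      (auto simp: single_apply bilinear_form_zero_right[OF B] component_closed act_zero)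
  also have "\<dots> = B (x g) (\<phi> g w)"
    using g c finite_group by (subst R.finsum_singleton) auto
  finally show ?thesis .
qed

text \<open>Testing against pure tensors treats one component at a time. The twist by the action is
  harmless because each \<open>\<phi> g\<close> is a bijection: surjectivity settles the first
  argument, injectivity the second.\<close>

lemma skew_form_nondegenerate:
  assumes B: "bilinear_form K \<Lambda> B" and nd: "nondegenerate_form K \<Lambda> B"
  shows "nondegenerate_form K \<Lambda>G (skew_form K G \<phi> B)"
  unfolding nondegenerate_form_def
proof (intro conjI ballI impI)
  fix x assume x: "x \<in> carrier \<Lambda>G" and x0: "\<forall>y \<in> carrier \<Lambda>G. skew_form K G \<phi> B x y = \<zero>"
  have "x g = \<zero>\<^bsub>\<Lambda>\<^esub>" if g: "g \<in> carrier G" for g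
  proof -
    have "B (x g) v = \<zero>" if v: "v \<in> carrier \<Lambda>" for v
    proof -
      \<comment> \<open>The test vector is the preimage of \<open>v\<close>, since the pairing sees
        it only after \<open>\<phi> g\<close> has been applied.\<close>
      obtain w where w: "w \<in> carrier \<Lambda>" "v = \<phi> g w"
        using action.surj_prop[OF g] v by blast
      show ?thesis
        unfolding w(2) skew_form_single_right[OF B x w(1) g, symmetric]
        by (rule x0[rule_format, OF single_closed[OF w(1)]])
    qed
    then show ?thesis
      using nd component_closed[OF x g] unfolding nondegenerate_form_def by blast
  qed
  then show "x = \<zero>\<^bsub>\<Lambda>G\<^esub>"
    by (intro skew_eqI x abelian_groupE(2)[OF skew_abelian_group]) (simp add: skew_zero_apply)
next
  fix y assume y: "y \<in> carrier \<Lambda>G" and y0: "\<forall>x \<in> carrier \<Lambda>G. skew_form K G \<phi> B x y = \<zero>"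
  have "y g = \<zero>\<^bsub>\<Lambda>\<^esub>" if g: "g \<in> carrier G" for g
  proof -
    \<comment> \<open>A pure tensor at \<open>inv g\<close> pairs with the component of
      \<open>y\<close> at \<open>inv (inv g)\<close>, which is \<open>g\<close>.\<close>
    let ?h = "inv\<^bsub>G\<^esub> g"
    have h: "?h \<in> carrier G" using g by simp
    have "B v (\<phi> ?h (y g)) = \<zero>" if "v \<in> carrier \<Lambda>" for v
      using skew_form_single_left[OF B that y h] y0 single_closed[OF that] g by simp
    \<comment> \<open>Nondegeneracy of \<open>B\<close> in its second argument gives zero, written
      as \<open>\<phi> ?h \<zero>\<close> so that injectivity applies.\<close>
    then have "\<phi> ?h (y g) = \<phi> ?h \<zero>\<^bsub>\<Lambda>\<^esub>"
      using nd act_closed[OF h component_closed[OF y g]]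
      unfolding nondegenerate_form_def act_zero[OF h] by blast
    then show ?thesis
      using inj_onD[OF action.inj_prop[OF h]] component_closed[OF y g] M.zero_closed by blast
  qed
  then show "y = \<zero>\<^bsub>\<Lambda>G\<^esub>"
    by (intro skew_eqI y abelian_groupE(2)[OF skew_abelian_group]) (simp add: skew_zero_apply)
qed

end

theorem lemma2p4:
  fixes K :: "('k, 'm) ring_scheme"
    and \<Lambda> :: "('k, 'a, 'n) module_scheme"
    and G :: "('g, 'p) monoid_scheme"
    and \<phi> :: "'g \<Rightarrow> 'a \<Rightarrow> 'a"
    and B :: "'a \<Rightarrow> 'a \<Rightarrow> 'k"
  assumes "fd_algebra K \<Lambda>"
    and "bilinear_form K \<Lambda> B" and "multiplicative_form \<Lambda> B" and "nondegenerate_form K \<Lambda> B"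
    and "finite_group_algebra_action K \<Lambda> G \<phi>"
  shows "bilinear_form K (skew_group_algebra \<Lambda> G \<phi>) (skew_form K G \<phi> B) \<and>
    multiplicative_form (skew_group_algebra \<Lambda> G \<phi>) (skew_form K G \<phi> B) \<and>
    nondegenerate_form K (skew_group_algebra \<Lambda> G \<phi>) (skew_form K G \<phi> B) \<and>
    frobenius_algebra K (skew_group_algebra \<Lambda> G \<phi>)"
proof -
  interpret finite_group_algebra_action K \<Lambda> G \<phi> by (rule assms(5))
  show ?thesis
    unfolding frobenius_algebra_def
    using skew_form_bilinear[OF assms(2,3)] skew_form_multiplicative[OF assms(2,3)]
      skew_form_nondegenerate[OF assms(2,4)] skew_fd_algebra by blast
qed

end
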